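(* For any integer $n\ge2$, $$\sum_{\pi\in\mathcal D_n}(-1)^{\ell_D(\pi)}t^{\mathrm{des}_D(\pi)}q^{\mathrm{maj}_D(\pi)} = \big(1+(-1)^{n-1}tq^{n-1}\big)\prod_{i=0}^{n-2}\left(1-tq^i\right),$$ and $\sum_{\pi\in\mathcal D_1}(-1)^{\ell_D(\pi)}t^{\mathrm{des}_D(\pi)}q^{\mathrm{maj}_D(\pi)}=1$.
   Context: $\mathcal D_n$ is the group of even-signed permutations: words $\pi=\pi_1\cdots\pi_n$ with $\pi_i\in\{\pm1,\dots,\pm n\}$ such that $|\pi_1|\cdots|\pi_n|$ is a permutation of $\{1,\dots,n\}$ and the number of negative $\pi_i$ is even. With respect to the natural order of integers: $\mathrm{inv}(\pi)=|\{(i,j):i<j,\ \pi_i>\pi_j\}|$; the type $D$ length is $\ell_D(\pi)=\mathrm{inv}(\pi)-\sum_{i:\,\pi_i<0}(\pi_i+1)$; $\mathrm{Des}_D(\pi)=\{i:0\le i\le n-1,\ \pi_i>\pi_{i+1}\}$ with $\pi_0:=-\pi_2$ (for $n=1$, where $\pi_2$ does not exist, $\mathrm{Des}_D(\pi)=\emptyset$); $\mathrm{des}_D(\pi)=|\mathrm{Des}_D(\pi)|$; $\mathrm{maj}_D(\pi)=\sum_{i\in\mathrm{Des}_D(\pi)}i$. $t,q$ are commuting indeterminates. *)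

theory Defs
  imports
    "HOL-Computational_Algebra.Polynomial"
    "HOL-Combinatorics.Multiset_Permutations"
begin

text \<open>
  A word \<open>\<pi>\<^sub>1 \<dots> \<pi>\<^sub>n\<close> is a list of integers; \<open>letter \<pi> i\<close> is \<open>\<pi>\<^sub>i\<close> in the 1-based indexing of
  the mathematics, extended by the type \<open>D\<close> convention \<open>\<pi>\<^sub>0 = - \<pi>\<^sub>2\<close>.
  (\<open>letter \<pi> 0\<close> is meaningful only for words of length at least 2.)
\<close>

definition letter :: "int list \<Rightarrow> nat \<Rightarrow> int" where
  "letter \<pi> i = (if i = 0 then - (\<pi> ! 1) else \<pi> ! (i - 1))"

definition Neg :: "int list \<Rightarrow> nat set" where
  "Neg \<pi> = {i \<in> {1..length \<pi>}. letter \<pi> i < 0}"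

definition even_signed_perms :: "nat \<Rightarrow> int list set" where
  "even_signed_perms n =
     {\<pi>. map abs \<pi> \<in> permutations_of_set {1..int n} \<and> even (card (Neg \<pi>))}"

definition inversions :: "int list \<Rightarrow> nat" where
  "inversions \<pi> =
     card {(i, j). i \<in> {1..length \<pi>} \<and> j \<in> {1..length \<pi>} \<and> i < j \<and> letter \<pi> i > letter \<pi> j}"

definition length_D :: "int list \<Rightarrow> int" where
  "length_D \<pi> = int (inversions \<pi>) - (\<Sum>i\<in>Neg \<pi>. letter \<pi> i + 1)"

text \<open>Words of length 1 have no \<open>\<pi>\<^sub>2\<close>, hence no \<open>\<pi>\<^sub>0\<close>, and by convention no descents.\<close>

definition Des_D :: "int list \<Rightarrow> nat set" where
  "Des_D \<pi> =
     (if length \<pi> \<le> 1 then {} else {i. i \<le> length \<pi> - 1 \<and> letter \<pi> i > letter \<pi> (i + 1)})"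

definition des_D :: "int list \<Rightarrow> nat" where
  "des_D \<pi> = card (Des_D \<pi>)"

definition maj_D :: "int list \<Rightarrow> nat" where
  "maj_D \<pi> = \<Sum> (Des_D \<pi>)"

text \<open>The two commuting indeterminates: \<open>\<int>[t, q]\<close> is realised as \<open>(\<int>[q])[t]\<close>.\<close>

definition indet_t :: "int poly poly" where
  "indet_t = [:0, 1:]"

definition indet_q :: "int poly poly" where
  "indet_q = [:[:0, 1:]:]"

text \<open>\<open>length_D\<close> is nonnegative, so the exponent \<open>nat (length_D \<pi>)\<close> of \<open>-1\<close> loses nothing.\<close>

lemma length_D_nonneg: "length_D \<pi> \<ge> 0"
proof -
  have "(\<Sum>i\<in>Neg \<pi>. letter \<pi> i + 1) \<le> 0"
    by (rule sum_nonpos) (auto simp: Neg_def)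
  then show ?thesis
    by (simp add: length_D_def)
qed

lemma finite_even_signed_perms: "finite (even_signed_perms n)"
proof (rule finite_subset)
  show "even_signed_perms n \<subseteq> {\<pi>. set \<pi> \<subseteq> {- int n..int n} \<and> length \<pi> = n}"
  proof
    fix \<pi> assume "\<pi> \<in> even_signed_perms n"
    then have *: "map abs \<pi> \<in> permutations_of_set {1..int n}"
      by (simp add: even_signed_perms_def)
    then have s: "abs ` set \<pi> = {1..int n}"
      using permutations_of_setD(1) by fastforce
    have "length \<pi> = n"
      using length_finite_permutations_of_set[OF *] by simp
    moreover have "set \<pi> \<subseteq> {- int n..int n}"
    proof
      fix x assume "x \<in> set \<pi>"
      then have "\<bar>x\<bar> \<in> {1..int n}" using s by blast
      then show "x \<in> {- int n..int n}" by auto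
    qed
    ultimately show "\<pi> \<in> {\<pi>. set \<pi> \<subseteq> {- int n..int n} \<and> length \<pi> = n}" by simp
  qed
qed (simp add: finite_lists_length_eq)

end

theory Submission
  imports Defs
begin

text \<open>
  For a signed permutation \<open>\<pi>\<close> (all words below have pairwise distinct absolute values) the sign
  \<open>(-1)\<^bsup>\<ell>\<^sub>D(\<pi>)\<^esup>\<close> is the ordinary sign of the unsigned permutation \<open>|\<pi>|\<close>: passing from \<open>\<pi>\<close> to
  \<open>|\<pi>|\<close> changes the status of the pair \<open>{x, y}\<close> as an inversion exactly when the letter of larger absolute value is
  negative, so a negative letter \<open>x\<close> contributes \<open>|x| - 1\<close> changes, and this is its contribution
  \<open>- (x + 1)\<close> to the length (\<open>sign_length_D\<close>). The other factor \<open>t\<^bsup>des\<^esup> q\<^bsup>maj\<^esup>\<close> is the product of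
  \<open>c i = t q\<^sup>i\<close> over the descents \<open>i\<close> of the word \<open>- \<pi>\<^sub>2, \<pi>\<^sub>1, \<pi>\<^sub>2, \<dots>\<close> (\<open>power_des_maj\<close>). The
  identity holds for an arbitrary sequence \<open>c\<close> of weights.

  Let \<open>a < b\<close> be the two least absolute values. A letter of larger absolute value compares with
  \<open>\<plusminus>a\<close> and with \<open>\<plusminus>b\<close> in the same way, so exchanging these two letters reverses the sign and can disturb a
  descent only if they are adjacent, or if the first position, which is also compared with
  the extra letter in front, is involved. There are two such exchanges: one in which every position
  keeps its sign, and one in which both positions change sign. The former keeps the
  order of \<open>\<plusminus>a\<close> and \<open>\<plusminus>b\<close> if their signs differ, the latter if their signs agree.
  Hence all words cancel in pairs, except those whose first two letters are the two least ones
  (\<open>sum_signed_words_block\<close>).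

  The initial two letters of the remaining words look like \<open>0\<close> to all letters after them, so the rest of the
  word is an arbitrary signed word with an extra letter \<open>0\<close> in front, that is, a word with type
  \<open>B\<close> descents, and the eight possible beginnings contribute the factor
  \<open>(1 - c 0) (1 - c 1)\<close>. For type \<open>D\<close> only the four beginnings of the right sign parity occur, but they contribute
  the same factor for either parity (\<open>even_signed_sum_step\<close>). The
  type \<open>B\<close> sum obeys the same recursion (\<open>signed_sum_step\<close>), which strips two letters at a time. If a single letter
  is left over, there is nothing to exchange it with, and its two signs give the factor \<open>1 + c (n - 1)\<close>; this is
  why the sign of the last factor of the product depends on the parity of \<open>n\<close>.
\<close>

section \<open>Signed words, signs and descent weights\<close>

definition signed_words :: "int set \<Rightarrow> int list set" where
  "signed_words A = {w. map abs w \<in> permutations_of_set A}"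

fun inv_count :: "int list \<Rightarrow> nat" where
  "inv_count [] = 0"
| "inv_count (x # w) = length (filter (\<lambda>y. y < x) w) + inv_count w"

text \<open>
  The first letter of \<open>w\<close> plays the part of \<open>\<pi>\<^sub>0\<close>, so that \<open>c i\<close> records a descent from \<open>\<pi>\<^sub>i\<close> to
  \<open>\<pi>\<^bsub>i+1\<^esub>\<close>: \<open>- \<pi>\<^sub>2\<close> is put in front for type \<open>D\<close> and \<open>0\<close> for type \<open>B\<close>. An arbitrary \<open>c\<close> in place
  of \<open>t q\<^sup>i\<close> lets the recursion absorb the shift of positions.
\<close>

fun descent_weight :: "(nat \<Rightarrow> 'a) \<Rightarrow> int list \<Rightarrow> 'a::comm_ring_1" where
  "descent_weight c (x # y # w) =
     (if y < x then c 0 else 1) * descent_weight (\<lambda>i. c (Suc i)) (y # w)"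
| "descent_weight c w = 1"

lemma signed_wordsD:
  assumes "w \<in> signed_words A"
  shows "distinct (map abs w)" "abs ` set w = A"
  using assms by (auto simp: signed_words_def permutations_of_set_def)

lemma signed_wordsI:
  "distinct (map abs w) \<Longrightarrow> abs ` set w = A \<Longrightarrow> w \<in> signed_words A"
  by (auto simp: signed_words_def permutations_of_set_def)

lemma length_signed_words: "w \<in> signed_words A \<Longrightarrow> length w = card A"
  by (metis distinct_card length_map list.set_map signed_wordsD)

lemma finite_signed_words:
  assumes "finite A" shows "finite (signed_words A)"
proof (rule finite_subset)
  show "signed_words A \<subseteq> {w. set w \<subseteq> A \<union> uminus ` A \<and> length w = card A}"
  proof
    fix w assume w: "w \<in> signed_words A"
    have "x \<in> A \<union> uminus ` A" if "x \<in> set w" for x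
    proof -
      have "\<bar>x\<bar> \<in> A" using signed_wordsD(2)[OF w] that by blast
      then show ?thesis by (cases "x \<ge> 0") (auto intro!: image_eqI[of _ _ "-x"])
    qed
    then show "w \<in> {w. set w \<subseteq> A \<union> uminus ` A \<and> length w = card A}"
      using length_signed_words[OF w] by auto
  qed
qed (use assms in \<open>auto intro: finite_lists_length_eq\<close>)

lemma descent_weight_map:
  assumes "distinct (map abs w)"
    and "\<And>u v. u \<in> set w \<Longrightarrow> v \<in> set w \<Longrightarrow> \<bar>u\<bar> \<noteq> \<bar>v\<bar> \<Longrightarrow> f v < f u \<longleftrightarrow> v < u"
  shows "descent_weight c (map f w) = descent_weight c w"
  using assms
proof (induction c w rule: descent_weight.induct)
  case (1 c x y w)
  have "f y < f x \<longleftrightarrow> y < x" using 1(2) by (intro 1(3)) auto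
  moreover have "descent_weight (\<lambda>i. c (Suc i)) (map f (y # w)) = descent_weight (\<lambda>i. c (Suc i)) (y # w)"
    using "1.prems" by (intro 1(1)) auto
  ultimately show ?case by simp
qed auto

lemma descent_weight_Cons_small:
  assumes "\<And>u. u \<in> set w \<Longrightarrow> \<bar>y\<bar> < \<bar>u\<bar>"
  shows "descent_weight c (y # w) = descent_weight c (0 # w)"
  using assms by (cases w) (force simp: abs_if split: if_splits)+

section \<open>Exchanging the two letters of least absolute value\<close>

text \<open>
  As no letter lies strictly between \<open>a\<close> and \<open>b\<close>, only the pair \<open>{a, b}\<close> itself changes its status as
  an inversion. Sublists that miss one of the two letters are included for the sake of the induction.
\<close>

lemma inv_count_transpose:
  assumes "a < b" "distinct w" "\<And>x. x \<in> set w \<Longrightarrow> x \<le> a \<or> b \<le> x"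
  shows "even (inv_count (map (transpose a b) w)) \<longleftrightarrow> (even (inv_count w) \<noteq> (a \<in> set w \<and> b \<in> set w))"
  using assms(2,3)
proof (induction w)
  case (Cons x w)
  let ?f = "\<lambda>w'. length (filter (\<lambda>y. y < x) w')"
  let ?g = "\<lambda>w'. length (filter (\<lambda>y. transpose a b y < transpose a b x) w')"
  have *: "\<forall>y\<in>set w. y \<noteq> x \<and> (y \<le> a \<or> b \<le> y)" "distinct w" "x \<le> a \<or> b \<le> x"
    using Cons.prems by auto
  have f: "?f w = card {y \<in> set w. y < x}" and g: "?g w = card {y \<in> set w. transpose a b y < transpose a b x}"
    using *(2) by (auto simp: distinct_length_filter Int_def conj_commute)
  have "even (?g w + ?f w) \<longleftrightarrow> \<not> (x = a \<and> b \<in> set w \<or> x = b \<and> a \<in> set w)"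
  proof -
    consider "x = a" | "x = b" | "x < a \<or> b < x" using *(3) by force
    then show ?thesis
    proof cases
      case 1
      have "{y \<in> set w. transpose a b y < transpose a b x} = {y \<in> set w. y < x} \<union> (set w \<inter> {b})"
        using * 1 assms(1) by (force simp: transpose_def split: if_splits)
      moreover have "{y \<in> set w. y < x} \<inter> (set w \<inter> {b}) = {}" using 1 assms(1) by auto
      ultimately have "?g w = ?f w + card (set w \<inter> {b})"
        unfolding f g by (simp add: card_Un_disjoint)
      then show ?thesis using 1 assms(1) by auto
    next
      case 2
      have "{y \<in> set w. y < x} = {y \<in> set w. transpose a b y < transpose a b x} \<union> (set w \<inter> {a})"
        using * 2 assms(1) by (force simp: transpose_def split: if_splits)
      moreover have "{y \<in> set w. transpose a b y < transpose a b x} \<inter> (set w \<inter> {a}) = {}" 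
        using 2 assms(1) by auto
      ultimately have "?f w = ?g w + card (set w \<inter> {a})"
        unfolding f g by (simp add: card_Un_disjoint)
      then show ?thesis using 2 assms(1) by auto
    next
      case 3
      then have "{y \<in> set w. transpose a b y < transpose a b x} = {y \<in> set w. y < x}"
        using * assms(1) by (intro Collect_cong) (force simp: transpose_def)
      then have "?g w = ?f w" unfolding f g by simp
      then show ?thesis using 3 assms(1) by auto
    qed
  qed
  moreover have "length (filter (\<lambda>y. y < transpose a b x) (map (transpose a b) w)) = ?g w"
    by (simp add: filter_map o_def)
  moreover note Cons.IH Cons.prems assms(1)
  ultimately show ?case by auto
qed simp

text \<open>
  For \<open>e = 1\<close> every position keeps its sign; for \<open>e = -1\<close> the positions of \<open>\<plusminus>a\<close> and \<open>\<plusminus>b\<close> also change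
  sign.
\<close>

definition exchange :: "int \<Rightarrow> int \<Rightarrow> int \<Rightarrow> int \<Rightarrow> int" where
  "exchange e a b x = (if \<bar>x\<bar> = a then e * sgn x * b else if \<bar>x\<bar> = b then e * sgn x * a else x)"

locale least_pair =
  fixes a b :: int and B :: "int set"
  assumes pos: "0 < a" "a < b" and above: "\<And>x. x \<in> B \<Longrightarrow> b < x" and fin: "finite B"
begin

definition alphabet where "alphabet = insert a (insert b B)"

lemma abs_exchange: "e \<in> {1,-1} \<Longrightarrow> \<bar>exchange e a b x\<bar> = transpose a b \<bar>x\<bar>"
  using pos by (auto simp: exchange_def transpose_def abs_mult)

lemma exchange_exchange: "e \<in> {1,-1} \<Longrightarrow> exchange e a b (exchange e a b x) = x"
  using pos by (auto simp: exchange_def abs_mult sgn_mult sgn_if)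

lemma exchange_minus: "exchange e a b (- x) = - exchange e a b x"
  by (auto simp: exchange_def sgn_if)

text \<open>
  Moving a letter between \<open>\<plusminus>a\<close> and \<open>\<plusminus>b\<close> without changing its sign matters neither to larger letters nor to
  \<open>0\<close>. If the exchange changes signs, \<open>0\<close> has to be excluded.
\<close>

lemma exchange_less_iff:
  assumes "\<bar>u\<bar> \<in> insert 0 alphabet" "\<bar>v\<bar> \<in> insert 0 alphabet" "\<bar>u\<bar> \<noteq> \<bar>v\<bar>"
    and "\<not> (\<bar>u\<bar> \<in> {a,b} \<and> \<bar>v\<bar> \<in> {a,b}) \<or> (0 < u \<longleftrightarrow> v < 0)"
  shows "exchange 1 a b v < exchange 1 a b u \<longleftrightarrow> v < u"
proof -
  have "\<bar>u\<bar> = 0 \<or> \<bar>u\<bar> = a \<or> \<bar>u\<bar> = b \<or> \<bar>u\<bar> > b" "\<bar>v\<bar> = 0 \<or> \<bar>v\<bar> = a \<or> \<bar>v\<bar> = b \<or> \<bar>v\<bar> > b"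
    using assms above by (auto simp: alphabet_def)
  then show ?thesis
    using assms(3,4) pos unfolding exchange_def by (elim disjE) (auto simp: sgn_if)
qed

lemma neg_exchange_less_iff:
  assumes "\<bar>u\<bar> \<in> alphabet" "\<bar>v\<bar> \<in> alphabet" "\<bar>u\<bar> \<noteq> \<bar>v\<bar>"
    and "\<not> (\<bar>u\<bar> \<in> {a,b} \<and> \<bar>v\<bar> \<in> {a,b}) \<or> (0 < u \<longleftrightarrow> 0 < v)"
  shows "exchange (-1) a b v < exchange (-1) a b u \<longleftrightarrow> v < u"
proof -
  have "\<bar>u\<bar> = a \<or> \<bar>u\<bar> = b \<or> \<bar>u\<bar> > b" "\<bar>v\<bar> = a \<or> \<bar>v\<bar> = b \<or> \<bar>v\<bar> > b"
    using assms above by (auto simp: alphabet_def)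
  then show ?thesis
    using assms(3,4) pos unfolding exchange_def by (elim disjE) (auto simp: sgn_if)
qed

lemma map_exchange_in_signed_words:
  assumes "e \<in> {1,-1}" "w \<in> signed_words alphabet"
  shows "map (exchange e a b) w \<in> signed_words alphabet"
proof -
  have m: "map abs (map (exchange e a b) w) = map (transpose a b) (map abs w)"
    using abs_exchange[OF assms(1)] by simp
  have "transpose a b ` alphabet = alphabet"
    using pos above by (force simp: alphabet_def transpose_def image_def)
  moreover have "set (map abs w) = alphabet" "distinct (map abs w)"
    using signed_wordsD[OF assms(2)] by auto
  moreover have "inj_on (transpose a b) S" for S
    by (rule inj_on_subset[OF inj_transpose]) simp
  ultimately show ?thesis
    unfolding signed_words_def permutations_of_set_def mem_Collect_eq m
    by (simp only: set_map distinct_map[of "transpose a b"])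
qed

lemma sign_exchange:
  assumes "e \<in> {1,-1}" "w \<in> signed_words alphabet"
  shows "(-1) ^ inv_count (map abs (map (exchange e a b) w)) = - ((-1) ^ inv_count (map abs w) :: 'a::comm_ring_1)"
proof -
  have m: "map abs (map (exchange e a b) w) = map (transpose a b) (map abs w)"
    using abs_exchange[OF assms(1)] by simp
  have "set (map abs w) = alphabet" "distinct (map abs w)"
    using signed_wordsD[OF assms(2)] by auto
  then have "even (inv_count (map (transpose a b) (map abs w))) \<longleftrightarrow> \<not> even (inv_count (map abs w))"
    using inv_count_transpose[of a b "map abs w"] pos above by (force simp: alphabet_def)
  then show ?thesis unfolding m by (simp add: minus_one_power_iff)
qed

text \<open>
  In a word over the alphabet exactly one of \<open>a\<close>, \<open>-a\<close> and exactly one of \<open>b\<close>, \<open>-b\<close> occurs.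
\<close>

definition same_sign :: "int list \<Rightarrow> bool" where
  "same_sign w \<longleftrightarrow> (a \<in> set w \<longleftrightarrow> b \<in> set w)"

lemma mem_iff_neg_notin:
  assumes "w \<in> signed_words alphabet" "x \<in> {a,b}"
  shows "- x \<in> set w \<longleftrightarrow> x \<notin> set w"
proof -
  have "x \<in> abs ` set w" using assms signed_wordsD(2) by (auto simp: alphabet_def)
  then obtain z where z: "z \<in> set w" "x = \<bar>z\<bar>" by auto
  then have "x \<in> set w \<or> - x \<in> set w" by (cases "z \<ge> 0") auto
  moreover have "inj_on abs (set w)" using signed_wordsD(1)[OF assms(1)] by (simp add: distinct_map)
  then have "x = - x" if "x \<in> set w" "- x \<in> set w"
    using inj_onD[of abs, OF _ _ that] by simp
  then have "\<not> (x \<in> set w \<and> - x \<in> set w)" using assms(2) pos by auto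
  ultimately show ?thesis by auto
qed

lemma same_sign_iff:
  assumes "w \<in> signed_words alphabet" "u \<in> set w" "v \<in> set w" "{\<bar>u\<bar>, \<bar>v\<bar>} = {a, b}"
  shows "same_sign w \<longleftrightarrow> (0 < u \<longleftrightarrow> 0 < v)"
  using assms mem_iff_neg_notin[OF assms(1), of a] mem_iff_neg_notin[OF assms(1), of b] pos
  by (auto simp: same_sign_def doubleton_eq_iff abs_if split: if_splits)

lemma exchange_mem_iff:
  assumes "e \<in> {1,-1}" shows "x \<in> exchange e a b ` S \<longleftrightarrow> exchange e a b x \<in> S"
  using exchange_exchange[OF assms] by (metis image_iff)

lemma same_sign_exchange:
  assumes "e \<in> {1,-1}" "w \<in> signed_words alphabet"
  shows "same_sign (map (exchange e a b) w) \<longleftrightarrow> same_sign w"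
proof -
  have "exchange e a b a = e * b" "exchange e a b b = e * a"
    using pos by (auto simp: exchange_def)
  then show ?thesis
    using assms(1) mem_iff_neg_notin[OF assms(2), of a] mem_iff_neg_notin[OF assms(2), of b]
    by (auto simp: same_sign_def exchange_mem_iff)
qed

abbreviation block :: "int set" where "block \<equiv> {a, b}"

lemma abs_exchange_block: "e \<in> {1,-1} \<Longrightarrow> \<bar>exchange e a b x\<bar> \<in> block \<longleftrightarrow> \<bar>x\<bar> \<in> block"
  by (auto simp: abs_exchange transpose_def)

lemma signed_words_Cons2:
  assumes "w \<in> signed_words alphabet" obtains x y v where "w = x # y # v"
proof -
  have "a \<notin> B" "b \<notin> B" using pos above by force+
  then have "card alphabet \<ge> 2" using pos fin by (simp add: alphabet_def)
  then have "length w \<ge> 2" using length_signed_words[OF assms] by simp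
  then show ?thesis using that by (metis Suc_le_length_iff numeral_2_eq_2)
qed

section \<open>Cancellation\<close>

lemma sum_exchange_cancel:
  fixes g :: "int list \<Rightarrow> 'a::{idom,ring_char_0}"
  assumes "e \<in> {1,-1}"
    and "\<And>w. w \<in> R \<Longrightarrow> map (exchange e a b) w \<in> R \<and> g (map (exchange e a b) w) = - g w"
  shows "sum g R = 0"
proof -
  have "sum g R = (\<Sum>w\<in>R. - g w)"
    by (rule sum.reindex_bij_witness[of R "map (exchange e a b)" "map (exchange e a b)"])
      (use assms exchange_exchange[OF assms(1)] in \<open>auto simp: o_def\<close>)
  then have "2 * sum g R = 0" by (simp add: sum_negf)
  then show ?thesis by simp
qed

text \<open>
  The words that do not begin with the block fall into two classes, each cancelled by one of the exchanges.
  If the first letter belongs to the block, the two block letters are not adjacent, and the exchange must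
  keep the sign of the first letter because of the letter in front of it. Otherwise the block letters may be adjacent, and
  their relative sign decides which exchange keeps their order.
\<close>

lemma sum_signed_words_block:
  fixes g :: "int list \<Rightarrow> 'a::{idom,ring_char_0}"
  assumes H: "\<And>w. w \<in> signed_words alphabet \<Longrightarrow> \<not> (\<bar>w!0\<bar> \<in> block \<and> \<bar>w!1\<bar> \<in> block) \<Longrightarrow> 
                 \<bar>w!0\<bar> \<in> block \<or> \<not> same_sign w \<Longrightarrow> g (map (exchange 1 a b) w) = - g w"
    and E: "\<And>w. w \<in> signed_words alphabet \<Longrightarrow> \<bar>w!0\<bar> \<notin> block \<Longrightarrow> same_sign w \<Longrightarrow>
                 g (map (exchange (-1) a b) w) = - g w"
  shows "sum g (signed_words alphabet) = 
         (\<Sum>v\<in>signed_words B. \<Sum>(x,y)\<in>{(a,b),(b,a),(-a,-b),(-b,-a),(a,-b),(b,-a),(-a,b),(-b,a)}. g (x # y # v))"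
proof -
  define P where "P = {(a,b),(b,a),(-a,-b),(-b,-a),(a,-b),(b,-a),(-a,b),(-b,a)}"
  have P: "(x,y) \<in> P \<longleftrightarrow> {\<bar>x\<bar>,\<bar>y\<bar>} = {a,b}" for x y
    using pos by (auto simp: P_def doubleton_eq_iff abs_if split: if_splits)
  define S0 S1 S2 where "S0 = {w \<in> signed_words alphabet. \<bar>w!0\<bar> \<in> block \<and> \<bar>w!1\<bar> \<in> block}"
    and "S1 = {w \<in> signed_words alphabet. \<not> (\<bar>w!0\<bar> \<in> block \<and> \<bar>w!1\<bar> \<in> block) \<and> (\<bar>w!0\<bar> \<in> block \<or> \<not> same_sign w)}"
    and "S2 = {w \<in> signed_words alphabet. \<bar>w!0\<bar> \<notin> block \<and> same_sign w}"
  have f: "finite (signed_words alphabet)" by (rule finite_signed_words) (simp add: alphabet_def fin)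
  have nth: "\<bar>map (exchange e a b) w ! i\<bar> \<in> block \<longleftrightarrow> \<bar>w ! i\<bar> \<in> block" 
    if "w \<in> signed_words alphabet" "e \<in> {1,-1}" "i < 2" for w e i
  proof -
    have "i < length w" using signed_words_Cons2[OF that(1)] that(3)
      by (metis length_Cons less_2_cases_iff zero_less_Suc Suc_less_eq One_nat_def)
    then show ?thesis using abs_exchange_block[OF that(2)] by simp
  qed
  have "signed_words alphabet = S0 \<union> (S1 \<union> S2)" "S0 \<inter> (S1 \<union> S2) = {}" "S1 \<inter> S2 = {}"
    by (auto simp: S0_def S1_def S2_def)
  moreover have "finite S0" "finite S1" "finite S2" using f by (auto simp: S0_def S1_def S2_def)
  ultimately have "sum g (signed_words alphabet) = sum g S0 + (sum g S1 + sum g S2)"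
    by (simp add: sum.union_disjoint)
  moreover have "sum g S1 = 0"
  proof (rule sum_exchange_cancel[of "1"])
    fix w assume "w \<in> S1"
    then have w: "w \<in> signed_words alphabet" and w': "\<not> (\<bar>w!0\<bar> \<in> block \<and> \<bar>w!1\<bar> \<in> block) \<and> (\<bar>w!0\<bar> \<in> block \<or> \<not> same_sign w)"
      unfolding S1_def by blast+
    have "map (exchange (1) a b) w \<in> S1"
      unfolding S1_def mem_Collect_eq
      using w' map_exchange_in_signed_words[OF _ w, of "1"] nth[OF w, of "1" 0] nth[OF w, of "1" 1]
        same_sign_exchange[OF _ w, of "1"] by simp
    moreover have "g (map (exchange (1) a b) w) = - g w"
      using w' H[OF w] by blast
    ultimately show "map (exchange (1) a b) w \<in> S1 \<and> g (map (exchange (1) a b) w) = - g w" ..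
  qed simp
  moreover have "sum g S2 = 0"
  proof (rule sum_exchange_cancel[of "-1"])
    fix w assume "w \<in> S2"
    then have w: "w \<in> signed_words alphabet" and w': "\<bar>w!0\<bar> \<notin> block \<and> same_sign w"
      unfolding S2_def by blast+
    have "map (exchange (-1) a b) w \<in> S2"
      unfolding S2_def mem_Collect_eq
      using w' map_exchange_in_signed_words[OF _ w, of "-1"] nth[OF w, of "-1" 0] nth[OF w, of "-1" 1]
        same_sign_exchange[OF _ w, of "-1"] by simp
    moreover have "g (map (exchange (-1) a b) w) = - g w"
      using w' E[OF w] by blast
    ultimately show "map (exchange (-1) a b) w \<in> S2 \<and> g (map (exchange (-1) a b) w) = - g w" ..
  qed simp
  moreover have "sum g S0 = (\<Sum>(v,x,y)\<in>signed_words B \<times> P. g (x # y # v))"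
  proof (rule sum.reindex_bij_witness[of _ "\<lambda>(v,x,y). x # y # v" "\<lambda>w. (drop 2 w, w!0, w!1)"])
    fix w assume "w \<in> S0"
    then have w: "w \<in> signed_words alphabet" "\<bar>w!0\<bar> \<in> block" "\<bar>w!1\<bar> \<in> block" by (auto simp: S0_def)
    obtain x y v where xy: "w = x # y # v" using signed_words_Cons2[OF w(1)] .
    have d: "distinct (map abs w)" "abs ` set w = alphabet" using signed_wordsD[OF w(1)] by auto
    show "(case (drop 2 w, w!0, w!1) of (v,x,y) \<Rightarrow> x # y # v) = w" using xy by simp
    show "(case (drop 2 w, w!0, w!1) of (v,x,y) \<Rightarrow> g (x # y # v)) = g w" using xy by simp
    have "\<bar>x\<bar> \<in> block" "\<bar>y\<bar> \<in> block" "\<bar>x\<bar> \<noteq> \<bar>y\<bar>" using w d(1) xy by simp_all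
    then have xyb: "{\<bar>x\<bar>,\<bar>y\<bar>} = {a,b}" by (auto simp: doubleton_eq_iff)
    have nb: "\<bar>x\<bar> \<notin> abs ` set v" "\<bar>y\<bar> \<notin> abs ` set v" using d(1) xy by auto
    have "insert \<bar>x\<bar> (insert \<bar>y\<bar> (abs ` set v)) = alphabet" using d(2) xy by simp
    then have "abs ` set v = alphabet - {\<bar>x\<bar>, \<bar>y\<bar>}" using nb by blast
    also have "\<dots> = B" unfolding xyb alphabet_def using pos above by force
    finally have "abs ` set v = B" .
    then have "v \<in> signed_words B" using d xy by (auto intro!: signed_wordsI)
    then show "(drop 2 w, w!0, w!1) \<in> signed_words B \<times> P" using xy xyb P by simp
  next
    fix z assume z: "z \<in> signed_words B \<times> P"
    obtain v x y where v: "z = (v,x,y)" by (cases z)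
    have d: "distinct (map abs v)" "abs ` set v = B" "{\<bar>x\<bar>,\<bar>y\<bar>} = {a,b}" 
      using z v signed_wordsD P by auto
    have "a \<notin> B" "b \<notin> B" using pos above by force+
    moreover have xyb: "\<bar>x\<bar> \<in> block" "\<bar>y\<bar> \<in> block" using d(3) by blast+
    ultimately have nb: "\<bar>x\<bar> \<notin> B" "\<bar>y\<bar> \<notin> B" by auto
    have ne: "\<bar>x\<bar> \<noteq> \<bar>y\<bar>" using d(3) pos by (auto simp: doubleton_eq_iff)
    have "insert \<bar>x\<bar> (insert \<bar>y\<bar> B) = {\<bar>x\<bar>, \<bar>y\<bar>} \<union> B" by blast
    then have "insert \<bar>x\<bar> (insert \<bar>y\<bar> B) = alphabet" unfolding d(3) alphabet_def by blast
    then have "x # y # v \<in> signed_words alphabet"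
      using d nb ne by (intro signed_wordsI) auto
    then show "(case z of (v,x,y) \<Rightarrow> x # y # v) \<in> S0" using v xyb by (simp add: S0_def)
    show "(drop 2 (case z of (v,x,y) \<Rightarrow> x # y # v), (case z of (v,x,y) \<Rightarrow> x # y # v) ! 0, 
           (case z of (v,x,y) \<Rightarrow> x # y # v) ! 1) = z"
      using v by simp
  qed
  ultimately show ?thesis unfolding P_def[symmetric] by (simp add: sum.cartesian_product)
qed

section \<open>Stripping the two least letters\<close>

lemma descent_weight_exchange:
  assumes w: "w \<in> signed_words alphabet" "\<not> (\<bar>w!0\<bar> \<in> block \<and> \<bar>w!1\<bar> \<in> block)" "\<bar>w!0\<bar> \<in> block \<or> \<not> same_sign w"
  shows "descent_weight c (map (exchange 1 a b) w) = descent_weight c w"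
proof -
  obtain x y v where xy: "w = x # y # v" using signed_words_Cons2[OF w(1)] .
  note d = signed_wordsD[OF w(1)]
  have mem: "\<bar>u\<bar> \<in> alphabet" if "u \<in> set w" for u using d(2) that by blast
  show ?thesis
  proof (cases "\<bar>x\<bar> \<in> block")
    case False
    then have ns: "\<not> same_sign w" using w(3) xy by simp
    show ?thesis
    proof (rule descent_weight_map[OF d(1)])
      fix u u' assume u: "u \<in> set w" "u' \<in> set w" "\<bar>u\<bar> \<noteq> \<bar>u'\<bar>"
      have "0 < u \<longleftrightarrow> u' < 0" if "\<bar>u\<bar> \<in> block" "\<bar>u'\<bar> \<in> block"
      proof -
        have "{\<bar>u\<bar>, \<bar>u'\<bar>} = {a, b}" using that u(3) by (auto simp: doubleton_eq_iff)
        then have "\<not> (0 < u \<longleftrightarrow> 0 < u')" using ns same_sign_iff[OF w(1) u(1,2)] by simp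
        moreover have "u' \<noteq> 0" using that pos by auto
        ultimately show ?thesis by linarith
      qed
      then show "exchange 1 a b u' < exchange 1 a b u \<longleftrightarrow> u' < u"
        using u mem by (intro exchange_less_iff) auto
    qed
  next
    case True
    \<comment> \<open>The block letters have arbitrary signs here, but are never adjacent: after the first position only one is left.\<close>
    then have y: "\<bar>y\<bar> \<notin> block" using w(2) xy by simp
    have "exchange 1 a b y < exchange 1 a b x \<longleftrightarrow> y < x"
      using y mem xy d(1) by (intro exchange_less_iff) auto
    moreover have "descent_weight (\<lambda>i. c (Suc i)) (map (exchange 1 a b) (y # v)) 
      = descent_weight (\<lambda>i. c (Suc i)) (y # v)"
    proof (rule descent_weight_map)
      show "distinct (map abs (y # v))" using d(1) xy by simp
      fix u u' assume u: "u \<in> set (y # v)" "u' \<in> set (y # v)" "\<bar>u\<bar> \<noteq> \<bar>u'\<bar>"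
      have "\<bar>x\<bar> \<notin> abs ` set (y # v)" using d(1) xy by simp
      then have "\<bar>u\<bar> \<noteq> \<bar>x\<bar>" "\<bar>u'\<bar> \<noteq> \<bar>x\<bar>" using u by (metis imageI)+
      then have "\<not> (\<bar>u\<bar> \<in> block \<and> \<bar>u'\<bar> \<in> block)" using True u(3) by auto
      moreover have "u \<in> set w" "u' \<in> set w" using u xy by auto
      ultimately show "exchange 1 a b u' < exchange 1 a b u \<longleftrightarrow> u' < u"
        using mem u(3) by (intro exchange_less_iff) auto
    qed
    ultimately show ?thesis using xy by simp
  qed
qed

lemma descent_weight_neg_exchange:
  assumes w: "w \<in> signed_words alphabet" "same_sign w"
  shows "descent_weight c (map (exchange (-1) a b) w) = descent_weight c w"
proof (rule descent_weight_map)
  note d = signed_wordsD[OF w(1)]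
  show "distinct (map abs w)" by (rule d)
  fix u u' assume u: "u \<in> set w" "u' \<in> set w" "\<bar>u\<bar> \<noteq> \<bar>u'\<bar>"
  have "0 < u \<longleftrightarrow> 0 < u'" if "\<bar>u\<bar> \<in> block" "\<bar>u'\<bar> \<in> block"
  proof -
    have "{\<bar>u\<bar>, \<bar>u'\<bar>} = {a, b}" using that u(3) by (auto simp: doubleton_eq_iff)
    then show ?thesis using w(2) same_sign_iff[OF w(1) u(1,2)] by simp
  qed
  moreover have "\<bar>u\<bar> \<in> alphabet" "\<bar>u'\<bar> \<in> alphabet" using d(2) u by blast+
  ultimately show "exchange (-1) a b u' < exchange (-1) a b u \<longleftrightarrow> u' < u"
    using u by (intro neg_exchange_less_iff) auto
qed

lemma inv_count_block:
  assumes "v \<in> signed_words B" "\<bar>x\<bar> \<in> block" "\<bar>y\<bar> \<in> block"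
  shows "inv_count (map abs (x # y # v)) = (if \<bar>y\<bar> < \<bar>x\<bar> then 1 else 0) + inv_count (map abs v)"
proof -
  have "b < \<bar>u\<bar>" if "u \<in> set v" for u using signed_wordsD(2)[OF assms(1)] that above by blast
  then have "\<forall>u\<in>set v. \<not> \<bar>u\<bar> < \<bar>x\<bar> \<and> \<not> \<bar>u\<bar> < \<bar>y\<bar>" using assms(2,3) pos by force
  then have "filter (\<lambda>u. \<bar>u\<bar> < \<bar>x\<bar>) v = []" "filter (\<lambda>u. \<bar>u\<bar> < \<bar>y\<bar>) v = []"
    by (auto simp: filter_empty_conv)
  then show ?thesis by (simp add: filter_map o_def)
qed

lemma descent_weight_block:
  assumes "v \<in> signed_words B" "\<bar>y\<bar> \<in> block"
  shows "descent_weight c (z # x # y # v) = (if x < z then c 0 else 1) * (if y < x then c 1 else 1)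
           * descent_weight (\<lambda>i. c (Suc (Suc i))) (0 # v)"
proof -
  have "b < \<bar>u\<bar>" if "u \<in> set v" for u using signed_wordsD(2)[OF assms(1)] that above by blast
  then have "\<bar>y\<bar> < \<bar>u\<bar>" if "u \<in> set v" for u using that assms(2) pos by force
  then have "descent_weight (\<lambda>i. c (Suc (Suc i))) (y # v) = descent_weight (\<lambda>i. c (Suc (Suc i))) (0 # v)"
    by (rule descent_weight_Cons_small)
  then show ?thesis by simp
qed

end

text \<open>
  The type \<open>B\<close> analogue of the sum in question: all signed words, and descents computed with \<open>\<pi>\<^sub>0 = 0\<close>.
\<close>

definition signed_sum :: "(nat \<Rightarrow> 'a) \<Rightarrow> int set \<Rightarrow> 'a::{idom,ring_char_0}" where
  "signed_sum c A = (\<Sum>w\<in>signed_words A. (-1) ^ inv_count (map abs w) * descent_weight c (0 # w))"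

context least_pair
begin

lemma sum_block:
  fixes g :: "int \<times> int \<Rightarrow> 'a::comm_ring_1"
  shows "sum g {(a,b),(b,a),(-a,-b),(-b,-a),(a,-b),(b,-a),(-a,b),(-b,a)} =
    g (a,b) + g (b,a) + g (-a,-b) + g (-b,-a) + g (a,-b) + g (b,-a) + g (-a,b) + g (-b,a)"
proof -
  have "a \<noteq> b" "b \<noteq> a" "a \<noteq> -b" "b \<noteq> -a" "-a \<noteq> b" "-b \<noteq> a" "a \<noteq> -a" "b \<noteq> -b" "-a \<noteq> a" "-b \<noteq> b" "-a \<noteq> -b" "-b \<noteq> -a"
    using pos by auto
  then show ?thesis by (simp add: add.assoc)
qed

text \<open>
  Of the eight beginnings, the four with different signs cancel in pairs; \<open>(a, b)\<close>, \<open>(b, a)\<close>, \<open>(-b, -a)\<close> and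
  \<open>(-a, -b)\<close> yield \<open>1\<close>, \<open>- c 1\<close>, \<open>- c 0\<close> and \<open>c 0 * c 1\<close>.
\<close>

lemma signed_sum_step:
  fixes c :: "nat \<Rightarrow> 'a::{idom,ring_char_0}"
  shows "signed_sum c alphabet = (1 - c 0) * (1 - c 1) * signed_sum (\<lambda>i. c (Suc (Suc i))) B"
proof -
  define g where "g w = (-1) ^ inv_count (map abs w) * descent_weight c (0 # w)" for w
  have head: "descent_weight c (0 # w) = (if w!0 < 0 then c 0 else 1) * descent_weight (\<lambda>i. c (Suc i)) w"
    if "w \<noteq> []" for w
    using that by (cases w) auto
  have ne: "w \<noteq> []" if "w \<in> signed_words alphabet" for w using signed_words_Cons2[OF that] by blast
  have "signed_sum c alphabet = (\<Sum>v\<in>signed_words B. \<Sum>(x,y)\<in>{(a,b),(b,a),(-a,-b),(-b,-a),(a,-b),(b,-a),(-a,b),(-b,a)}. g (x # y # v))"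
    unfolding signed_sum_def g_def[symmetric]
  proof (rule sum_signed_words_block)
    fix w assume w: "w \<in> signed_words alphabet" "\<not> (\<bar>w!0\<bar> \<in> block \<and> \<bar>w!1\<bar> \<in> block)" "\<bar>w!0\<bar> \<in> block \<or> \<not> same_sign w"
    have "exchange 1 a b (w!0) < 0 \<longleftrightarrow> w!0 < 0"
      using pos by (auto simp: exchange_def sgn_if)
    then show "g (map (exchange 1 a b) w) = - g w"
      using ne[OF w(1)] sign_exchange[where 'a = 'a, OF _ w(1), of 1] descent_weight_exchange[OF w, of "\<lambda>i. c (Suc i)"]
      by (simp add: g_def head del: map_map)
  next
    fix w assume w: "w \<in> signed_words alphabet" "\<bar>w!0\<bar> \<notin> block" "same_sign w"
    have "exchange (-1) a b (w!0) = w!0"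
      using w(2) by (auto simp: exchange_def)
    then show "g (map (exchange (-1) a b) w) = - g w"
      using ne[OF w(1)] sign_exchange[where 'a = 'a, OF _ w(1), of "-1"] descent_weight_neg_exchange[OF w(1,3), of "\<lambda>i. c (Suc i)"]
      by (simp add: g_def head del: map_map)
  qed
  also have "\<dots> = (\<Sum>v\<in>signed_words B. (1 - c 0) * (1 - c 1) * 
     ((-1) ^ inv_count (map abs v) * descent_weight (\<lambda>i. c (Suc (Suc i))) (0 # v)))"
    using pos unfolding sum_block g_def
    by (intro sum.cong refl) (simp add: inv_count_block descent_weight_block algebra_simps
        del: inv_count.simps descent_weight.simps list.map)
  finally show ?thesis by (simp add: signed_sum_def sum_distrib_left)
qed

text \<open>The exchange with sign changes acts on exactly two positions, so it preserves the even-signed words.\<close>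

lemma length_filter_neg_exchange:
  assumes "w \<in> signed_words alphabet"
  shows "even (length (filter (\<lambda>x. x < 0) (map (exchange (-1) a b) w))) \<longleftrightarrow> even (length (filter (\<lambda>x. x < 0) w))"
proof -
  have "length (filter (\<lambda>x. \<bar>x\<bar> \<in> block) w) = length (filter (\<lambda>x. x \<in> block) (map abs w))"
    by (simp add: filter_map o_def)
  also have "\<dots> = card (alphabet \<inter> block)"
    using signed_wordsD[OF assms] by (subst distinct_length_filter) (auto simp: Int_def conj_commute)
  also have "alphabet \<inter> block = block" by (auto simp: alphabet_def)
  finally have 1: "even (length (filter (\<lambda>x. \<bar>x\<bar> \<in> block) w))" using pos by simp
  have "exchange (-1) a b x < 0 \<longleftrightarrow> (x < 0) \<noteq> (\<bar>x\<bar> \<in> block)" for x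
    using pos by (auto simp: exchange_def sgn_if)
  then have "even (length (filter (\<lambda>x. x < 0) (map (exchange (-1) a b) w)) + length (filter (\<lambda>x. x < 0) w)
     + length (filter (\<lambda>x. \<bar>x\<bar> \<in> block) w))"
    by (induction w) (auto simp del: insert_iff)
  then show ?thesis using 1 by simp
qed

text \<open>
  Here the descent at \<open>0\<close> is \<open>x < - y\<close> for the first two letters \<open>x\<close>, \<open>y\<close>, a comparison that the odd function
  \<open>exchange\<close> respects unless both letters belong to the block. The parity of the rest of the word decides which four
  beginnings occur: those with equal signs behave as for type \<open>B\<close>, and \<open>(-a, b)\<close>, \<open>(b, -a)\<close>, \<open>(-b, a)\<close>, \<open>(a, -b)\<close>
  also yield \<open>1\<close>, \<open>- c 1\<close>, \<open>- c 0\<close> and \<open>c 0 * c 1\<close>.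
\<close>

lemma even_signed_sum_step:
  fixes c :: "nat \<Rightarrow> 'a::{idom,ring_char_0}"
  shows "(\<Sum>w\<in>{w \<in> signed_words alphabet. even (length (filter (\<lambda>x. x < 0) w))}. 
      (-1) ^ inv_count (map abs w) * descent_weight c (- (w!1) # w))
    = (1 - c 0) * (1 - c 1) * signed_sum (\<lambda>i. c (Suc (Suc i))) B"
proof -
  \<comment> \<open>Extending by \<open>0\<close> to the other parity makes the sum range over all signed words, as the cancellation requires.\<close>
  define g where "g w = (if even (length (filter (\<lambda>x. x < 0) w)) 
     then (-1) ^ inv_count (map abs w) * descent_weight c (- (w!1) # w) else 0)" for w
  have f: "finite (signed_words alphabet)" by (rule finite_signed_words) (simp add: alphabet_def fin)
  have mem: "\<bar>w!i\<bar> \<in> alphabet" if "w \<in> signed_words alphabet" "i < 2" for w i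
    using signed_words_Cons2[OF that(1)] signed_wordsD(2)[OF that(1)] that(2)
    by (metis One_nat_def imageI less_2_cases list.set_intros nth_Cons_0 nth_Cons_Suc)
  have head: "descent_weight c (z # w) = (if w!0 < z then c 0 else 1) * descent_weight (\<lambda>i. c (Suc i)) w"
    if "w \<noteq> []" for w z
    using that by (cases w) auto
  have "(\<Sum>w\<in>{w \<in> signed_words alphabet. even (length (filter (\<lambda>x. x < 0) w))}. 
      (-1) ^ inv_count (map abs w) * descent_weight c (- (w!1) # w)) = sum g (signed_words alphabet)"
    unfolding g_def by (rule sum.inter_filter[OF f])
  also have "\<dots> = (\<Sum>v\<in>signed_words B. \<Sum>(x,y)\<in>{(a,b),(b,a),(-a,-b),(-b,-a),(a,-b),(b,-a),(-a,b),(-b,a)}. g (x # y # v))"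
  proof (rule sum_signed_words_block)
    fix w assume w: "w \<in> signed_words alphabet" "\<not> (\<bar>w!0\<bar> \<in> block \<and> \<bar>w!1\<bar> \<in> block)" "\<bar>w!0\<bar> \<in> block \<or> \<not> same_sign w"
    obtain x y v where xy: "w = x # y # v" using signed_words_Cons2[OF w(1)] .
    have "exchange 1 a b x < exchange 1 a b (- y) \<longleftrightarrow> x < - y"
      using w(2) mem[OF w(1), of 0] mem[OF w(1), of 1] signed_wordsD(1)[OF w(1)] xy
      by (intro exchange_less_iff) auto
    then have 1: "exchange 1 a b x < - exchange 1 a b y \<longleftrightarrow> x < - y" by (simp add: exchange_minus)
    have "exchange 1 a b x < 0 \<longleftrightarrow> x < 0" for x
      using pos by (auto simp: exchange_def sgn_if)
    then have 2: "length (filter (\<lambda>x. x < 0) (map (exchange 1 a b) w)) = length (filter (\<lambda>x. x < 0) w)"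
      by (simp add: filter_map o_def)
    have 3: "descent_weight c (- (map (exchange 1 a b) w ! 1) # map (exchange 1 a b) w) = 
        descent_weight c (- (w!1) # w)"
      using 1 descent_weight_exchange[OF w, of "\<lambda>i. c (Suc i)"] xy
      by (subst (1 2) head) (simp_all del: descent_weight.simps list.map add: nth_map)
    show "g (map (exchange 1 a b) w) = - g w"
      unfolding g_def 2 3 using sign_exchange[where 'a = 'a, OF _ w(1), of 1] by (simp del: map_map)
  next
    fix w assume w: "w \<in> signed_words alphabet" "\<bar>w!0\<bar> \<notin> block" "same_sign w"
    obtain x y v where xy: "w = x # y # v" using signed_words_Cons2[OF w(1)] .
    have "exchange (-1) a b x < exchange (-1) a b (- y) \<longleftrightarrow> x < - y"
      using w(2) mem[OF w(1), of 0] mem[OF w(1), of 1] signed_wordsD(1)[OF w(1)] xy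
      by (intro neg_exchange_less_iff) auto
    then have 1: "exchange (-1) a b x < - exchange (-1) a b y \<longleftrightarrow> x < - y" by (simp add: exchange_minus)
    have 3: "descent_weight c (- (map (exchange (-1) a b) w ! 1) # map (exchange (-1) a b) w) = 
        descent_weight c (- (w!1) # w)"
      using 1 descent_weight_neg_exchange[OF w(1,3), of "\<lambda>i. c (Suc i)"] xy
      by (subst (1 2) head) (simp_all del: descent_weight.simps list.map add: nth_map)
    show "g (map (exchange (-1) a b) w) = - g w"
      unfolding g_def 3 length_filter_neg_exchange[OF w(1)] 
      using sign_exchange[where 'a = 'a, OF _ w(1), of "-1"] by (simp del: map_map)
  qed
  also have "\<dots> = (\<Sum>v\<in>signed_words B. (1 - c 0) * (1 - c 1) * 
     ((-1) ^ inv_count (map abs v) * descent_weight (\<lambda>i. c (Suc (Suc i))) (0 # v)))"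
    using pos unfolding sum_block g_def
    by (intro sum.cong refl) (simp add: inv_count_block descent_weight_block algebra_simps
        del: inv_count.simps descent_weight.simps list.map)
  finally show ?thesis by (simp add: signed_sum_def sum_distrib_left)
qed

end

lemma signed_words_empty: "signed_words {} = {[]}"
  by (auto simp: signed_words_def)

lemma signed_words_singleton:
  assumes "0 < z" shows "signed_words {z} = {[z], [-z]}"
proof -
  have "map abs w = [z] \<longleftrightarrow> w = [z] \<or> w = [-z]" for w
    using assms by (cases w) (auto simp: abs_if)
  then show ?thesis by (auto simp: signed_words_def permutations_of_set_singleton)
qed

lemma signed_sum_interval:
  assumes "0 \<le> l"
  shows "signed_sum c {l+1..l+int m} = 
    (\<Prod>i<2 * (m div 2). 1 - c i) * (if odd m then 1 + c (m - 1) else 1)"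
  using assms
proof (induction m arbitrary: c l rule: induct_nat_012)
  case 0
  then show ?case by (simp add: signed_sum_def signed_words_empty)
next
  case 1
  have "{l+1..l+int (Suc 0)} = {l+1}" by auto
  then show ?case using 1 by (simp add: signed_sum_def signed_words_singleton)
next
  case (ge2 m)
  interpret least_pair "l+1" "l+2" "{l+2+1..l+2+int m}"
    using ge2.prems by unfold_locales auto
  let ?tail = "if odd m then 1 + c (Suc (Suc (m - 1))) else 1"
  have "{l+1..l+int (Suc (Suc m))} = alphabet" unfolding alphabet_def by auto
  then have "signed_sum c {l+1..l+int (Suc (Suc m))} = 
      (1 - c 0) * (1 - c 1) * signed_sum (\<lambda>i. c (Suc (Suc i))) {l+2+1..l+2+int m}"
    using signed_sum_step[of c] by metis
  also have "\<dots> = (1 - c 0) * (1 - c 1) * ((\<Prod>i<2 * (m div 2). 1 - c (Suc (Suc i))) * ?tail)"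
    using ge2.prems by (subst ge2.IH(1)) simp_all
  also have "\<dots> = (\<Prod>i<Suc (Suc (2 * (m div 2))). 1 - c i) * ?tail"
    by (simp add: prod.lessThan_Suc_shift mult.assoc del: prod.lessThan_Suc)
  also have "Suc (Suc (2 * (m div 2))) = 2 * (Suc (Suc m) div 2)" by simp
  also have "?tail = (if odd (Suc (Suc m)) then 1 + c (Suc (Suc m) - 1) else 1)"
    by (cases m) auto
  finally show ?case .
qed

section \<open>The type \<open>D\<close> length, descents and major index\<close>

lemma descent_weight_conv_prod:
  "descent_weight c w = (\<Prod>i<length w - 1. if w ! Suc i < w ! i then c i else 1)"
  by (induction c w rule: descent_weight.induct) (simp_all add: prod.lessThan_Suc_shift del: prod.lessThan_Suc)

lemma inversions_conv_inv_count: "inversions w = inv_count w"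
proof -
  have "inversions w = card {(i, j). i < j \<and> j < length w \<and> w ! j < w ! i}"
    unfolding inversions_def
    by (rule bij_betw_same_card[of "\<lambda>(i,j). (i - 1, j - 1)"],
        rule bij_betw_byWitness[where f' = "\<lambda>(i,j). (Suc i, Suc j)"]) (auto simp: letter_def)
  also have "\<dots> = inv_count w"
  proof (induction w)
    case (Cons x w)
    let ?I = "\<lambda>w. {(i, j). i < j \<and> j < length w \<and> w ! j < w ! i}"
    have "?I (x # w) = (\<lambda>j. (0, Suc j)) ` {j. j < length w \<and> w ! j < x} \<union> map_prod Suc Suc ` ?I w" (is "_ = ?L \<union> ?R")
    proof (rule set_eqI)
      fix p :: "nat \<times> nat"
      obtain i j where p: "p = (i,j)" by (cases p)
      show "p \<in> ?I (x # w) \<longleftrightarrow> p \<in> ?L \<union> ?R"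
        unfolding p by (cases i; cases j) (auto simp: image_iff)
    qed
    moreover have "?L \<inter> ?R = {}" by auto
    moreover have "finite (?I w)" by (rule finite_subset[of _ "{..<length w} \<times> {..<length w}"]) auto
    moreover have "card ?L = length (filter (\<lambda>y. y < x) w)"
      by (subst card_image) (auto simp: inj_on_def length_filter_conv_card)
    moreover have "card ?R = card (?I w)"
      by (subst card_image) (auto simp: inj_on_def)
    ultimately show ?case using Cons by (simp add: card_Un_disjoint)
  qed simp
  finally show ?thesis .
qed

lemma sum_Neg: "(\<Sum>i\<in>Neg w. f (letter w i)) = (\<Sum>x\<leftarrow>w. if x < 0 then f x else (0::'a::comm_monoid_add))"
proof -
  have "(\<Sum>i\<in>Neg w. f (letter w i)) = (\<Sum>i\<in>{1..length w}. if letter w i < 0 then f (letter w i) else 0)"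
    unfolding Neg_def by (rule sum.inter_filter) simp
  also have "\<dots> = (\<Sum>i<length w. if w ! i < 0 then f (w ! i) else 0)"
    by (rule sum.reindex_bij_witness[of _ Suc "\<lambda>i. i - 1"]) (auto simp: letter_def)
  finally show ?thesis by (simp add: sum_list_sum_nth atLeast0LessThan)
qed

lemma card_Neg: "card (Neg w) = length (filter (\<lambda>x. x < 0) w)"
proof -
  have "card (Neg w) = (\<Sum>x\<leftarrow>w. if x < 0 then 1 else 0)"
    using sum_Neg[of "\<lambda>_. 1::nat" w] by simp
  also have "\<dots> = length (filter (\<lambda>x. x < 0) w)" by (induction w) auto
  finally show ?thesis .
qed

text \<open>
  For \<open>|x| < |y|\<close> the pair in either order is an inversion of just one of \<open>w\<close> and \<open>map abs w\<close> if and only if \<open>y < 0\<close>;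
  the sum counts these pairs by their letter of larger absolute value.
\<close>

lemma inv_count_abs_parity:
  assumes "distinct (map abs w)"
  shows "even (inv_count w + inv_count (map abs w) + 
    (\<Sum>x\<leftarrow>w. if x < 0 then length (filter (\<lambda>y. \<bar>y\<bar> < \<bar>x\<bar>) w) else 0))"
  using assms
proof (induction w)
  case (Cons x w)
  let ?N = "\<lambda>w'. (\<Sum>y\<leftarrow>w'. if y < 0 then length (filter (\<lambda>z. \<bar>z\<bar> < \<bar>y\<bar>) w) else 0)"
  let ?e = "if x < 0 then length (filter (\<lambda>y. \<bar>y\<bar> < \<bar>x\<bar>) w) else 0"
  have later: "(\<Sum>y\<leftarrow>w'. if y < 0 then length (filter (\<lambda>z. \<bar>z\<bar> < \<bar>y\<bar>) (x # w)) else 0)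
    = length (filter (\<lambda>y. y < 0 \<and> \<bar>x\<bar> < \<bar>y\<bar>) w') + ?N w'" for w'
    by (induction w') auto
  have "x \<notin> set w \<and> \<bar>x\<bar> \<notin> abs ` set w" using Cons.prems by auto
  then have first: "even (length (filter (\<lambda>y. y < x) w) + length (filter (\<lambda>y. \<bar>y\<bar> < \<bar>x\<bar>) w) + ?e
     + length (filter (\<lambda>y. y < 0 \<and> \<bar>x\<bar> < \<bar>y\<bar>) w))"
  proof (induction w)
    case (Cons y w)
    have "\<bar>x\<bar> \<noteq> \<bar>y\<bar>" using Cons.prems by auto
    then consider "\<bar>x\<bar> < \<bar>y\<bar>" | "\<bar>y\<bar> < \<bar>x\<bar>" by linarith
    then show ?case
      using Cons by cases (cases "x < 0"; cases "y < 0"; auto)+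
  qed simp
  have rest: "even (inv_count w + inv_count (map abs w) + ?N w)" using Cons by simp
  have "length (filter (\<lambda>y. y < \<bar>x\<bar>) (map abs w)) = length (filter (\<lambda>y. \<bar>y\<bar> < \<bar>x\<bar>) w)"
    by (simp add: filter_map o_def)
  then have "inv_count (x # w) + inv_count (map abs (x # w)) + 
    (\<Sum>y\<leftarrow>x # w. if y < 0 then length (filter (\<lambda>z. \<bar>z\<bar> < \<bar>y\<bar>) (x # w)) else 0)
    = (length (filter (\<lambda>y. y < x) w) + length (filter (\<lambda>y. \<bar>y\<bar> < \<bar>x\<bar>) w) + ?e
     + length (filter (\<lambda>y. y < 0 \<and> \<bar>x\<bar> < \<bar>y\<bar>) w)) + (inv_count w + inv_count (map abs w) + ?N w)"
    using later[of w] by simp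
  then show ?case using first rest by (simp only: even_add[of "_ + _" "inv_count w + _ + _"])
qed simp

lemma sign_length_D:
  assumes "w \<in> signed_words {1..int n}"
  shows "(-1) ^ nat (length_D w) = ((-1) ^ inv_count (map abs w) :: 'a::comm_ring_1)"
proof -
  let ?N = "\<Sum>x\<leftarrow>w. if x < 0 then length (filter (\<lambda>y. \<bar>y\<bar> < \<bar>x\<bar>) w) else 0"
  note d = signed_wordsD[OF assms]
  have smaller: "int (length (filter (\<lambda>y. \<bar>y\<bar> < \<bar>x\<bar>) w)) = \<bar>x\<bar> - 1" if "x \<in> set w" for x
  proof -
    have x: "\<bar>x\<bar> \<in> {1..int n}" using d(2) that by blast
    have "length (filter (\<lambda>y. \<bar>y\<bar> < \<bar>x\<bar>) w) = length (filter (\<lambda>y. y < \<bar>x\<bar>) (map abs w))"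
      by (simp add: filter_map o_def)
    also have "\<dots> = card ({y. y < \<bar>x\<bar>} \<inter> {1..int n})"
      using d by (subst distinct_length_filter) auto
    also have "{y. y < \<bar>x\<bar>} \<inter> {1..int n} = {1..\<bar>x\<bar> - 1}" using x by auto
    finally show ?thesis using x by auto
  qed
  have "(\<Sum>i\<in>Neg w. letter w i + 1) = (\<Sum>x\<leftarrow>w. if x < 0 then x + 1 else 0)"
    by (rule sum_Neg)
  also have "\<dots> = - (\<Sum>x\<leftarrow>w. int (if x < 0 then length (filter (\<lambda>y. \<bar>y\<bar> < \<bar>x\<bar>) w) else 0))"
    unfolding uminus_sum_list_map o_def
  proof (intro arg_cong[where f = sum_list] map_cong refl)
    fix x assume x: "x \<in> set w"
    show "(if x < 0 then x + 1 else 0) = - int (if x < 0 then length (filter (\<lambda>y. \<bar>y\<bar> < \<bar>x\<bar>) w) else 0)"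
    proof (cases "x < 0")
      case True
      then show ?thesis using smaller[OF x] unfolding if_P[OF True] by linarith
    qed simp
  qed
  also have "\<dots> = - int ?N" by (simp only: sum_list_of_nat[symmetric] map_map o_def)
  finally have "nat (length_D w) = inv_count w + ?N"
    by (simp add: length_D_def inversions_conv_inv_count)
  then have "even (nat (length_D w)) \<longleftrightarrow> (even (inv_count w) \<longleftrightarrow> even ?N)"
    by (simp only: even_add)
  moreover have "(even (inv_count w) \<longleftrightarrow> even (inv_count (map abs w))) \<longleftrightarrow> even ?N"
    using inv_count_abs_parity[OF d(1)] by (simp only: even_add)
  ultimately have "even (nat (length_D w)) \<longleftrightarrow> even (inv_count (map abs w))"
    by blast
  then show ?thesis by (simp add: minus_one_power_iff)
qed

lemma power_des_maj:
  fixes t q :: "'a::comm_ring_1"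
  assumes "2 \<le> length w"
  shows "t ^ des_D w * q ^ maj_D w = descent_weight (\<lambda>i. t * q ^ i) (- (w ! 1) # w)"
proof -
  let ?c = "\<lambda>i. t * q ^ i"
  have D: "Des_D w = {i \<in> {..<length w}. w ! i < (- (w ! 1) # w) ! i}"
  proof (rule set_eqI)
    fix i show "i \<in> Des_D w \<longleftrightarrow> i \<in> {i \<in> {..<length w}. w ! i < (- (w ! 1) # w) ! i}"
      using assms by (cases i) (auto simp: Des_D_def letter_def)
  qed
  have "t ^ des_D w * q ^ maj_D w = (\<Prod>i\<in>Des_D w. ?c i)"
    by (simp add: des_D_def maj_D_def prod.distrib power_sum)
  also have "\<dots> = (\<Prod>i<length w. if w ! i < (- (w ! 1) # w) ! i then ?c i else 1)"
    unfolding D by (rule prod.inter_filter) simp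
  also have "\<dots> = descent_weight ?c (- (w ! 1) # w)"
    by (simp add: descent_weight_conv_prod)
  finally show ?thesis .
qed

lemma even_signed_perms_conv:
  "even_signed_perms n = {w \<in> signed_words {1..int n}. even (length (filter (\<lambda>x. x < 0) w))}"
  by (auto simp: even_signed_perms_def signed_words_def card_Neg)

section \<open>The signed generating function\<close>

lemma signed_major_sum_D:
  fixes t q :: "'a::{idom,ring_char_0}"
  assumes "2 \<le> n"
  shows "(\<Sum>\<pi>\<in>even_signed_perms n. (-1) ^ nat (length_D \<pi>) * t ^ des_D \<pi> * q ^ maj_D \<pi>)
      = (1 + (-1) ^ (n - 1) * t * q ^ (n - 1)) * (\<Prod>i=0..n-2. 1 - t * q ^ i)"
proof -
  define c where "c = (\<lambda>i. t * q ^ i)"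
  obtain m where n: "n = Suc (Suc m)" using assms by (metis Suc_le_D numeral_2_eq_2 Suc_le_mono)
  interpret least_pair 1 2 "{2+1..2+int m}" by unfold_locales auto
  have alphabet: "alphabet = {1..int n}" unfolding alphabet_def using n by auto
  have "(\<Sum>\<pi>\<in>even_signed_perms n. (-1) ^ nat (length_D \<pi>) * t ^ des_D \<pi> * q ^ maj_D \<pi>)
    = (\<Sum>w\<in>{w \<in> signed_words alphabet. even (length (filter (\<lambda>x. x < 0) w))}. 
      (-1) ^ inv_count (map abs w) * descent_weight c (- (w!1) # w))"
    unfolding alphabet even_signed_perms_conv
  proof (intro sum.cong refl)
    fix w assume "w \<in> {w \<in> signed_words {1..int n}. even (length (filter (\<lambda>x. x < 0) w))}"
    then have w: "w \<in> signed_words {1..int n}" by simp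
    then have "2 \<le> length w" using length_signed_words[OF w] assms by simp
    then show "(-1) ^ nat (length_D w) * t ^ des_D w * q ^ maj_D w = 
        (-1) ^ inv_count (map abs w) * descent_weight c (- (w!1) # w)"
      using power_des_maj[of w t q] sign_length_D[OF w, where 'a = 'a] by (simp add: c_def mult.assoc)
  qed
  also have "\<dots> = (1 - c 0) * (1 - c 1) * signed_sum (\<lambda>i. c (Suc (Suc i))) {2+1..2+int m}"
    by (rule even_signed_sum_step)
  also have "\<dots> = (1 - c 0) * (1 - c 1) * 
     ((\<Prod>i<2 * (m div 2). 1 - c (Suc (Suc i))) * (if odd m then 1 + c (Suc (Suc (m - 1))) else 1))"
    by (subst signed_sum_interval) simp_all
  also have "\<dots> = (\<Prod>i<Suc (Suc (2 * (m div 2))). 1 - c i) * (if odd m then 1 + c (Suc (Suc (m - 1))) else 1)"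
    by (simp add: prod.lessThan_Suc_shift mult.assoc del: prod.lessThan_Suc)
  also have "\<dots> = (1 + (-1) ^ (n - 1) * c (n - 1)) * (\<Prod>i<n - 1. 1 - c i)"
  proof (cases "odd m")
    case True
    then obtain k where "m = 2 * k + 1" by (auto elim: oddE)
    then show ?thesis using n by simp
  next
    case False
    then obtain k where "m = 2 * k" by auto
    then show ?thesis using n by simp
  qed
  also have "{..<n - 1} = {0..n - 2}" using n by auto
  finally show ?thesis by (simp add: c_def mult.assoc)
qed

lemma even_signed_perms_1: "even_signed_perms 1 = {[1]}"
  by (auto simp: even_signed_perms_conv signed_words_singleton)

theorem theorem5p3:
  shows "(\<forall>n\<ge>2.
      (\<Sum>\<pi>\<in>even_signed_perms n.
         (-1) ^ nat (length_D \<pi>) * indet_t ^ des_D \<pi> * indet_q ^ maj_D \<pi>)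
      = (1 + (-1) ^ (n - 1) * indet_t * indet_q ^ (n - 1))
        * (\<Prod>i=0..n-2. 1 - indet_t * indet_q ^ i))
    \<and> (\<Sum>\<pi>\<in>even_signed_perms 1.
         (-1) ^ nat (length_D \<pi>) * indet_t ^ des_D \<pi> * indet_q ^ maj_D \<pi>) = 1"
proof (intro conjI allI impI)
  have "(-1) ^ nat (length_D [1]) = (1 :: int poly poly)"
    using sign_length_D[of "[1]" 1] by (simp add: signed_words_singleton)
  then show "(\<Sum>\<pi>\<in>even_signed_perms 1.
         (-1) ^ nat (length_D \<pi>) * indet_t ^ des_D \<pi> * indet_q ^ maj_D \<pi>) = 1"
    unfolding even_signed_perms_1 by (simp add: des_D_def maj_D_def Des_D_def)
qed (rule signed_major_sum_D)

end
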